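(* Let $n$ be a positive integer and let $p(x)$ be a polynomial with real coefficients of degree at most $n-1$ with $p(1)=1$. Then $$\max_{x\in[-1,1]}|(1-x)p(x)|\;\geq\;\frac{2\sin\left(\frac{\pi}{2n}\right)}{n\left(1+\cos\left(\frac{\pi}{2n}\right)\right)},$$ with equality if and only if $p(x)=S_{n-1}(x)$, where $$S_{n-1}(x)=\frac{1}{x-1}\cdot\frac{2\sin\left(\frac{\pi}{2n}\right)}{n\left(1+\cos\left(\frac{\pi}{2n}\right)\right)}\cdot T_n\!\left(\frac{1+\cos\left(\frac{\pi}{2n}\right)}{2}(x+1)-1\right).$$
   Context: The Chebyshev polynomials $T_k$ are defined by $T_0(x)=1$, $T_1(x)=x$, $T_{k+1}(x)=2xT_k(x)-T_{k-1}(x)$. The expression $S_{n-1}(x)$ is a polynomial in $x$ (the factor $T_n(\cdot)$ vanishes at $x=1$, so the division by $x-1$ is exact), and its value at $x=1$ is that of this polynomial. *)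

theory Defs
  imports "HOL-Analysis.Analysis" "HOL-Computational_Algebra.Polynomial"
begin

fun chebyshev_T :: "nat \<Rightarrow> real poly" where
  "chebyshev_T 0 = 1"
| "chebyshev_T (Suc 0) = [:0, 1:]"
| "chebyshev_T (Suc (Suc k)) = [:0, 2:] * chebyshev_T (Suc k) - chebyshev_T k"

definition extremal_value :: "nat \<Rightarrow> real" where
  "extremal_value n =
     2 * sin (pi / (2 * real n)) / (real n * (1 + cos (pi / (2 * real n))))"

text \<open>
  In the next two definitions the argument \<open>n\<close> is the degree of the Chebyshev polynomial, so
  \<open>extremal_poly n\<close> is the polynomial usually written with index \<open>n - 1\<close>.
\<close>

definition scaled_T :: "nat \<Rightarrow> real poly" where
  "scaled_T n = smult (extremal_value n)
     (pcompose (chebyshev_T n) (smult ((1 + cos (pi / (2 * real n))) / 2) [:1, 1:] - 1))"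

text \<open>
  This is polynomial division by \<open>x - 1\<close>; it is exact for \<open>n > 0\<close> by
  \<open>extremal_poly_exact\<close> below.
\<close>

definition extremal_poly :: "nat \<Rightarrow> real poly" where
  "extremal_poly n = scaled_T n div [:-1, 1:]"

lemma chebyshev_T_cos: "poly (chebyshev_T n) (cos t) = cos (real n * t)"
proof (induction n rule: chebyshev_T.induct)
  case (3 k)
  have "cos (real (Suc (Suc k)) * t) = cos (real (Suc k) * t + t)"
    by (simp add: algebra_simps)
  moreover have "cos (real k * t) = cos (real (Suc k) * t - t)"
    by (simp add: algebra_simps)
  ultimately have "cos (real (Suc (Suc k)) * t) + cos (real k * t) = 2 * cos t * cos (real (Suc k) * t)"
    unfolding cos_add cos_diff by simp
  with 3 show ?case by simp
qed simp_all

lemma extremal_poly_exact: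
  assumes "n > 0"
  shows "[:-1, 1:] * extremal_poly n = scaled_T n"
proof -
  have "real n * (pi / (2 * real n)) = pi / 2"
    using assms by simp
  then have "cos (real n * (pi / (2 * real n))) = 0"
    by (simp only: cos_pi_half)
  then have "poly (scaled_T n) 1 = 0"
    using chebyshev_T_cos[of n "pi / (2 * real n)"] by (simp add: scaled_T_def poly_pcompose)
  then have "[:-1, 1:] dvd scaled_T n"
    using poly_eq_0_iff_dvd[of "scaled_T n" 1] by simp
  then show ?thesis
    by (simp only: extremal_poly_def dvd_mult_div_cancel)
qed

lemma poly_extremal_poly:
  assumes "n > 0" "x \<noteq> 1"
  shows "poly (extremal_poly n) x =
    1 / (x - 1) * extremal_value n *
      poly (chebyshev_T n) ((1 + cos (pi / (2 * real n))) / 2 * (x + 1) - 1)"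
proof -
  have "poly ([:-1, 1:] * extremal_poly n) x = poly (scaled_T n) x"
    using extremal_poly_exact[OF assms(1)] by simp
  then have "(x - 1) * poly (extremal_poly n) x = poly (scaled_T n) x"
    by (simp add: algebra_simps)
  then have "poly (extremal_poly n) x = 1 / (x - 1) * poly (scaled_T n) x"
    using assms(2) by (simp add: field_simps)
  also have "poly (scaled_T n) x = extremal_value n *
      poly (chebyshev_T n) ((1 + cos (pi / (2 * real n))) / 2 * (x + 1) - 1)"
    unfolding scaled_T_def poly_smult poly_pcompose poly_diff poly_1 by (simp add: add.commute)
  finally show ?thesis by (simp add: mult.assoc)
qed

text \<open>
  For a polynomial the supremum of \<open>\<bar>(1 - x) * p x\<bar>\<close> over the compact interval is attained,
  so \<open>SUP\<close> expresses the maximum.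
\<close>

lemma SUP_attained:
  fixes p :: "real poly"
  obtains x where "x \<in> {-1..1}"
    and "\<bar>(1 - x) * poly p x\<bar> = (SUP y\<in>{-1..1}. \<bar>(1 - y) * poly p y\<bar>)"
    and "\<And>y. y \<in> {-1..1} \<Longrightarrow> \<bar>(1 - y) * poly p y\<bar> \<le> \<bar>(1 - x) * poly p x\<bar>"
proof -
  let ?f = "\<lambda>x. \<bar>(1 - x) * poly p x\<bar>"
  have "continuous_on {-1..1} ?f"
    by (intro continuous_intros)
  then obtain x where x: "x \<in> {-1..1}" "\<And>y. y \<in> {-1..1} \<Longrightarrow> ?f y \<le> ?f x"
    using continuous_attains_sup[of "{-1..1::real}" ?f] by auto
  have "Sup (?f ` {-1..1}) = ?f x"
    using x by (intro cSup_eq_maximum) auto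
  with x that show ?thesis by metis
qed

end

theory Submission
  imports Defs
begin

text \<open>
  The polynomial \<open>(x - 1) * extremal_poly n\<close> is a rescaled Chebyshev polynomial that takes the
  values \<open>\<plusminus> extremal_value n\<close> with alternating signs at \<open>n\<close> points of \<open>[-1, 1)\<close>, and whose
  derivative at the root \<open>1\<close> is \<open>1\<close>. If \<open>(x - 1) * p\<close> is bounded by \<open>extremal_value n\<close>, then the
  difference of the two is divisible by \<open>(x - 1)\<^sup>2\<close>, and the quotient, of degree at most \<open>n - 2\<close>, has
  weakly alternating signs at these \<open>n\<close> points. Its divided difference of order \<open>n - 1\<close> vanishes
  but is a sum of terms of equal sign, so the quotient vanishes at all \<open>n\<close> points and is \<open>0\<close>.
\<close>

section \<open>Divided differences and sign alternation\<close>

text \<open>The sum is the coefficient of degree \<open>m\<close> of the Lagrange interpolant of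
  \<open>q\<close> at \<open>m + 1\<close> nodes; as \<open>degree q < m\<close>, the interpolant is
  \<open>q\<close> itself and has no such coefficient.\<close>

lemma sum_divided_difference_eq_0:
  fixes x :: "nat \<Rightarrow> real" and q :: "real poly"
  assumes inj: "inj_on x {..m}" and deg: "degree q < m"
  shows "(\<Sum>k\<le>m. poly q (x k) / (\<Prod>j\<in>{..m}-{k}. x k - x j)) = 0"
proof -
  \<comment> \<open>Lagrange basis polynomials without their denominators: each is monic of degree
    \<open>m\<close>, so the top coefficient of \<open>L\<close> is the sum of the weights
    \<open>w k\<close>.\<close>
  define l where "l k = (\<Prod>j\<in>{..m}-{k}. [:- x j, 1:])" for k
  define w where "w k = poly q (x k) / (\<Prod>j\<in>{..m}-{k}. x k - x j)" for k
  define L where "L = (\<Sum>k\<le>m. smult (w k) (l k))"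
  have deg_l: "degree (l k) = m" if "k \<le> m" for k
    using that by (simp add: l_def degree_prod_eq_sum_degree)
  have monic_l: "coeff (l k) m = 1" if "k \<le> m" for k
    using deg_l[OF that] lead_coeff_prod[of "\<lambda>j. [:- x j, 1:]" "{..m}-{k}"] by (simp add: l_def)
  have poly_l: "poly (l k) y = (\<Prod>j\<in>{..m}-{k}. y - x j)" for k y
    by (simp add: l_def poly_prod)
  have "poly L (x i) = poly q (x i)" if "i \<le> m" for i
  proof -
    have "poly L (x i) = (\<Sum>k\<le>m. w k * poly (l k) (x i))"
      by (simp add: L_def poly_sum)
    also have "\<dots> = (\<Sum>k\<in>{i}. w k * poly (l k) (x i))"
    proof (rule sum.mono_neutral_right)
      show "\<forall>k\<in>{..m} - {i}. w k * poly (l k) (x i) = 0"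
        using that by (auto simp: poly_l)
    qed (use that in auto)
    also have "\<dots> = poly q (x i)"
    proof -
      have "(\<Prod>j\<in>{..m}-{i}. x i - x j) \<noteq> 0"
        using inj that by (auto simp: inj_on_def)
      then show ?thesis by (simp add: w_def poly_l)
    qed
    finally show ?thesis .
  qed
  then have "\<And>y. y \<in> x ` {..m} \<Longrightarrow> poly L y = poly q y"
    by auto
  moreover have "card (x ` {..m}) = Suc m"
    using inj by (simp add: card_image)
  moreover have "degree L \<le> m"
    unfolding L_def using deg_l by (intro degree_sum_le) (auto intro: order.trans[OF degree_smult_le])
  ultimately have "L = q"
    using deg by (intro poly_eqI_degree[of "x ` {..m}"]) auto
  then have "coeff L m = 0"
    using deg by (simp add: coeff_eq_0)
  then show ?thesis
    by (simp add: L_def coeff_sum monic_l w_def)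
qed

text \<open>Exactly \<open>k\<close> nodes lie above \<open>x k\<close>, so the denominators of the
  divided difference alternate in sign as the values of \<open>q\<close> do. All terms are then
  nonnegative with sum 0, which makes every node a root: more roots than the degree allows.\<close>

lemma poly_eq_0_if_alternating:
  fixes x :: "nat \<Rightarrow> real" and q :: "real poly"
  assumes dec: "\<And>i j. i < j \<Longrightarrow> j \<le> m \<Longrightarrow> x j < x i"
    and deg: "degree q < m"
    and alt: "\<And>k. k \<le> m \<Longrightarrow> (-1) ^ k * poly q (x k) \<ge> 0"
  shows "q = 0"
proof -
  have inj: "inj_on x {..m}"
    by (rule linorder_inj_onI') (use dec in force)
  let ?W = "\<lambda>k. \<Prod>j\<in>{..m}-{k}. x k - x j"
  have W: "(-1) ^ k * ?W k > 0" if k: "k \<le> m" for k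
  proof -
    have "{..m} - {k} = {..<k} \<union> {k<..m}"
      using k by auto
    then have "?W k = (\<Prod>j<k. x k - x j) * (\<Prod>j\<in>{k<..m}. x k - x j)"
      by (simp add: prod.union_disjoint Int_def)
    moreover have "(\<Prod>j<k. x k - x j) = (-1) ^ k * (\<Prod>j<k. x j - x k)"
      using prod.distrib[of "\<lambda>_. -1" "\<lambda>j. x j - x k" "{..<k}"] by simp
    moreover have "(-1) ^ k * ((-1) ^ k * r) = r" for r :: real
      by (simp flip: mult.assoc power_mult_distrib)
    moreover have "(\<Prod>j<k. x j - x k) > 0" "(\<Prod>j\<in>{k<..m}. x k - x j) > 0"
      using k dec by (auto intro!: prod_pos)
    ultimately show ?thesis
      by (simp add: mult.assoc)
  qed
  have nonneg: "poly q (x k) / ?W k \<ge> 0" if "k \<le> m" for k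
  proof -
    have "poly q (x k) / ?W k = ((-1) ^ k * poly q (x k)) / ((-1) ^ k * ?W k)"
      by simp
    also have "\<dots> \<ge> 0"
      using alt[OF that] W[OF that] by (intro divide_nonneg_pos)
    finally show ?thesis .
  qed
  have "poly q (x k) = 0" if k: "k \<le> m" for k
  proof -
    have "poly q (x k) / ?W k = 0"
      using sum_nonneg_eq_0_iff[of "{..m}" "\<lambda>k. poly q (x k) / ?W k"] nonneg k
        sum_divided_difference_eq_0[OF inj deg] by simp
    moreover have "?W k \<noteq> 0"
      using W[OF k] by (metis less_irrefl mult_zero_right)
    ultimately show ?thesis by (simp only: divide_eq_0_iff) simp
  qed
  then show ?thesis
    using inj deg by (intro poly_eqI_degree[of "x ` {..m}"]) (auto simp: card_image)
qed

section \<open>Chebyshev polynomials on the interval\<close>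

lemma degree_chebyshev_T: "degree (chebyshev_T n) \<le> n"
proof (induction n rule: chebyshev_T.induct)
  case (3 k)
  have "degree ([:0, 2:] * chebyshev_T (Suc k)) \<le> Suc (Suc k)"
    using degree_mult_le[of "[:0, 2:]" "chebyshev_T (Suc k)"] 3 by simp
  then show ?case
    using 3 by (auto intro!: degree_diff_le)
qed simp_all

text \<open>Obtained by differentiating \<open>chebyshev_T_cos\<close>; the factor
  \<open>sin t\<close> is kept on the left, so that no case distinction at its zeros arises.\<close>

lemma pderiv_chebyshev_T_cos:
  "poly (pderiv (chebyshev_T n)) (cos t) * sin t = real n * sin (real n * t)"
proof -
  have "((\<lambda>t. poly (chebyshev_T n) (cos t)) has_real_derivative
      poly (pderiv (chebyshev_T n)) (cos t) * - sin t) (at t)"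
    by (rule DERIV_chain2[OF poly_DERIV]) (auto intro!: derivative_eq_intros)
  moreover have "((\<lambda>t. cos (real n * t)) has_real_derivative - sin (real n * t) * real n) (at t)"
    by (auto intro!: derivative_eq_intros)
  ultimately show ?thesis
    by (auto simp: chebyshev_T_cos mult.commute dest: DERIV_unique)
qed

lemma abs_chebyshev_T_le_1:
  assumes "\<bar>u\<bar> \<le> 1"
  shows "\<bar>poly (chebyshev_T n) u\<bar> \<le> 1"
  using chebyshev_T_cos[of n "arccos u"] assms by (simp add: cos_arccos abs_le_iff)

section \<open>The rescaled Chebyshev polynomial\<close>

text \<open>The angle lies in the first quadrant. For \<open>n = 1\<close> it equals
  \<open>pi / 2\<close> and its cosine is 0, hence the weak bound.\<close>

lemma
  assumes "n > 0"
  shows cos_half_step_nonneg: "cos (pi / (2 * real n)) \<ge> 0"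
    and sin_half_step_pos: "sin (pi / (2 * real n)) > 0"
proof -
  have "pi / (2 * real n) \<le> pi / 2" "pi / (2 * real n) > 0"
    using assms by (simp_all add: field_simps)
  then show "cos (pi / (2 * real n)) \<ge> 0" "sin (pi / (2 * real n)) > 0"
    by (auto intro!: cos_ge_zero sin_gt_zero simp: less_le_trans)
qed

lemma extremal_value_pos: "n > 0 \<Longrightarrow> extremal_value n > 0"
  using cos_half_step_nonneg[of n] sin_half_step_pos[of n]
  by (auto simp: extremal_value_def intro!: divide_pos_pos mult_pos_pos)

lemma poly_scaled_T:
  "poly (scaled_T n) x =
    extremal_value n * poly (chebyshev_T n) ((1 + cos (pi / (2 * real n))) / 2 * (x + 1) - 1)"
  unfolding scaled_T_def poly_smult poly_pcompose poly_diff poly_1 by (simp add: add.commute)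

text \<open>The affine change of variable maps the interval from -1 to 1 into itself, since its
  slope \<open>a\<close> lies between 0 and 1 and it fixes -1.\<close>

lemma abs_scaled_T_le:
  assumes "n > 0" "x \<in> {-1..1}"
  shows "\<bar>poly (scaled_T n) x\<bar> \<le> extremal_value n"
proof -
  define a where "a = (1 + cos (pi / (2 * real n))) / 2"
  have "0 \<le> a" "a \<le> 1"
    using cos_half_step_nonneg[OF assms(1)] by (auto simp: a_def)
  then have "0 \<le> a * (x + 1)" "a * (x + 1) \<le> 1 * 2"
    using assms(2) by (simp, intro mult_mono) auto
  then have "\<bar>poly (chebyshev_T n) (a * (x + 1) - 1)\<bar> \<le> 1"
    by (intro abs_chebyshev_T_le_1) auto
  then show ?thesis
    using extremal_value_pos[OF assms(1)]
    by (simp add: poly_scaled_T a_def abs_mult mult_left_le)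
qed

text \<open>The value at 1 is the derivative of \<open>scaled_T n\<close> there. The derivative of
  \<open>chebyshev_T n\<close> at its root \<open>c\<close> is \<open>n / s\<close>, the inner slope
  is \<open>(1 + c) / 2\<close>, and \<open>extremal_value n\<close> is the reciprocal of their
  product.\<close>

lemma poly_extremal_poly_1:
  assumes "n > 0"
  shows "poly (extremal_poly n) 1 = 1"
proof -
  define c s where "c = cos (pi / (2 * real n))" and "s = sin (pi / (2 * real n))"
  have s: "s > 0" and c: "c \<ge> 0"
    using sin_half_step_pos[OF assms] cos_half_step_nonneg[OF assms] by (simp_all add: s_def c_def)
  have "real n * (pi / (2 * real n)) = pi / 2"
    using assms by simp
  then have "poly (pderiv (chebyshev_T n)) c * s = real n"
    using pderiv_chebyshev_T_cos[of n "pi / (2 * real n)"] by (simp only: c_def s_def sin_pi_half)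
  then have T': "poly (pderiv (chebyshev_T n)) c = real n / s"
    using s by (simp add: field_simps)
  have "((\<lambda>x. extremal_value n * poly (chebyshev_T n) ((1 + c) / 2 * (x + 1) - 1))
      has_real_derivative extremal_value n * (poly (pderiv (chebyshev_T n)) c * ((1 + c) / 2))) (at 1)"
  proof (rule DERIV_cmult, rule DERIV_chain2[where f = "poly (chebyshev_T n)"])
    show "(poly (chebyshev_T n) has_real_derivative poly (pderiv (chebyshev_T n)) c)
        (at ((1 + c) / 2 * (1 + 1) - 1))"
    proof -
      have "(1 + c) / 2 * (1 + 1) - 1 = c"
        by (simp add: field_simps)
      then show ?thesis
        by (simp only: poly_DERIV)
    qed
    show "((\<lambda>x. (1 + c) / 2 * (x + 1) - 1) has_real_derivative (1 + c) / 2) (at 1)"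
      by (auto intro!: derivative_eq_intros)
  qed
  then have "(poly (scaled_T n) has_real_derivative
      extremal_value n * (real n / s * ((1 + c) / 2))) (at 1)"
    by (simp only: T' poly_scaled_T[abs_def] c_def[symmetric])
  also have "extremal_value n * (real n / s * ((1 + c) / 2)) = 1"
    using s c assms unfolding extremal_value_def c_def[symmetric] s_def[symmetric]
    by (simp add: divide_simps add_eq_0_iff)
  finally have "poly (pderiv (scaled_T n)) 1 = 1"
    using poly_DERIV DERIV_unique by blast
  \<comment> \<open>Product rule: the other summand carries the factor \<open>x - 1\<close>, which
    vanishes at 1.\<close>
  moreover have "poly (pderiv ([:-1, 1:] * extremal_poly n)) 1 = poly (extremal_poly n) 1"
    by (simp only: pderiv_mult pderiv_pCons) (simp add: pderiv_pCons)
  ultimately show ?thesis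
    by (simp only: extremal_poly_exact[OF assms])
qed

lemma degree_extremal_poly:
  assumes "n > 0"
  shows "degree (extremal_poly n) \<le> n - 1"
proof -
  have "degree (smult ((1 + cos (pi / (2 * real n))) / 2) [:1, 1:] - 1) \<le> 1"
    by (intro degree_diff_le order.trans[OF degree_smult_le]) auto
  then have "degree (scaled_T n) \<le> n * 1"
    unfolding scaled_T_def
    by (intro order.trans[OF degree_smult_le] order.trans[OF degree_pcompose_le]
        mult_mono degree_chebyshev_T) auto
  moreover have "extremal_poly n \<noteq> 0"
    using poly_extremal_poly_1[OF assms] by auto
  then have "degree ([:-1, 1:] * extremal_poly n) = 1 + degree (extremal_poly n)"
    by (subst degree_mult_eq) auto
  ultimately show ?thesis
    by (simp only: extremal_poly_exact[OF assms])
qed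

text \<open>The points are preimages of extremal points of \<open>chebyshev_T n\<close>. The
  extremal point \<open>cos 0 = 1\<close> is left out, because its preimage lies to the right of 1;
  this causes the shift to \<open>Suc k\<close> and the minus sign.\<close>

lemma scaled_T_alternation:
  assumes "n > 0"
  obtains x :: "nat \<Rightarrow> real" where
    "\<And>i j. i < j \<Longrightarrow> j < n \<Longrightarrow> x j < x i"
    "\<And>k. k < n \<Longrightarrow> x k \<in> {-1..<1}"
    "\<And>k. k < n \<Longrightarrow> poly (scaled_T n) (x k) = - ((-1) ^ k * extremal_value n)"
proof
  define c where "c = cos (pi / (2 * real n))"
  define u where "u k = cos (real (Suc k) * pi / real n)" for k
  \<comment> \<open>The inverse of the affine map \<open>(1 + c) / 2 * (x + 1) - 1\<close>.\<close>
  define x where "x k = (u k + 1) * 2 / (1 + c) - 1" for k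
  have c: "1 + c > 0"
    using cos_half_step_nonneg[OF assms] by (simp add: c_def)
  have le_pi: "real (Suc k) * pi / real n \<le> pi" if "k < n" for k
    using that assms by (simp add: field_simps del: of_nat_Suc)
  show "x j < x i" if "i < j" "j < n" for i j
  proof -
    have "u j < u i"
      unfolding u_def using that assms le_pi[of j]
      by (intro cos_monotone_0_pi) (auto intro!: divide_strict_right_mono mult_strict_right_mono)
    then show ?thesis
      using c by (simp add: x_def divide_strict_right_mono)
  qed
  fix k assume k: "k < n"
  have "1 * pi \<le> real (Suc k) * pi"
    by (intro mult_right_mono) auto
  then have "pi / (2 * real n) < real (Suc k) * pi / real n"
    using assms by (simp add: field_simps add_pos_nonneg)
  then have "u k < c"
    unfolding u_def c_def using le_pi[OF k] by (intro cos_monotone_0_pi) auto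
  moreover have "u k \<ge> -1"
    by (simp add: u_def)
  ultimately show "x k \<in> {-1..<1}"
    using c by (auto simp: x_def field_simps)
  have "(1 + c) / 2 * (x k + 1) - 1 = u k"
    using c by (auto simp: x_def field_simps)
  then have "poly (scaled_T n) (x k) = extremal_value n * poly (chebyshev_T n) (u k)"
    by (simp add: poly_scaled_T flip: c_def)
  also have "poly (chebyshev_T n) (u k) = cos (real (Suc k) * pi)"
    using assms by (simp add: u_def chebyshev_T_cos del: of_nat_Suc)
  also have "\<dots> = (-1) ^ Suc k"
    by (rule cos_npi)
  finally show "poly (scaled_T n) (x k) = - ((-1) ^ k * extremal_value n)"
    by simp
qed

section \<open>Optimality and uniqueness\<close>

text \<open>Since the bound is weak, this gives both the lower bound for the maximum and the
  equality case.\<close>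

lemma eq_extremal_poly_if_bounded:
  fixes p :: "real poly"
  assumes n: "n > 0" and deg: "degree p \<le> n - 1" and p1: "poly p 1 = 1"
    and bd: "\<And>x. x \<in> {-1..1} \<Longrightarrow> \<bar>(1 - x) * poly p x\<bar> \<le> extremal_value n"
  shows "p = extremal_poly n"
proof (rule ccontr)
  assume neq: "p \<noteq> extremal_poly n"
  obtain x where
    dec: "\<And>i j. i < j \<Longrightarrow> j < n \<Longrightarrow> x j < x i" and
    x: "\<And>k. k < n \<Longrightarrow> x k \<in> {-1..<1}" and
    alt: "\<And>k. k < n \<Longrightarrow> poly (scaled_T n) (x k) = - ((-1) ^ k * extremal_value n)"
    using scaled_T_alternation[OF n] by blast
  define g where "g = p - extremal_poly n"
  have "poly g 1 = 0"
    by (simp add: g_def p1 poly_extremal_poly_1[OF n])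
  then obtain q where q: "g = [:-1, 1:] * q"
    using poly_eq_0_iff_dvd[of g 1] by (auto simp: dvd_def)
  have q0: "q \<noteq> 0"
    using neq q by (auto simp: g_def)
  then have "degree g = 1 + degree q"
    unfolding q by (subst degree_mult_eq) auto
  moreover have "degree g \<le> n - 1"
    unfolding g_def by (intro degree_diff_le deg degree_extremal_poly n)
  \<comment> \<open>For \<open>n = 1\<close> the two facts about \<open>degree g\<close> already
    contradict each other.\<close>
  ultimately have degq: "degree q < n - 1"
    by simp
  have "q = 0"
  proof (rule poly_eq_0_if_alternating[OF _ degq])
    show "x j < x i" if "i < j" "j \<le> n - 1" for i j
      using dec[of i j] that n by simp
    fix k assume "k \<le> n - 1"
    then have k: "k < n"
      using n by simp
    let ?y = "x k"
    have "poly ([:-1, 1:] * extremal_poly n) ?y = - ((-1) ^ k * extremal_value n)"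
      using alt[OF k] by (simp only: extremal_poly_exact[OF n])
    then have "(?y - 1) * poly (extremal_poly n) ?y = - ((-1) ^ k * extremal_value n)"
      by (simp add: algebra_simps)
    moreover have "poly p ?y = poly (extremal_poly n) ?y + (?y - 1) * poly q ?y"
    proof -
      have "poly (p - extremal_poly n) ?y = poly ([:-1, 1:] * q) ?y"
        using q by (simp add: g_def)
      then show ?thesis by (simp add: algebra_simps)
    qed
    \<comment> \<open>Here \<open>r\<close> and \<open>s\<close> stand for the values of
      \<open>q\<close> and \<open>extremal_poly n\<close> at \<open>?y\<close>.\<close>
    moreover have "(?y - 1)\<^sup>2 * r = (?y - 1) * (s + (?y - 1) * r) - (?y - 1) * s" for r s
      by (simp add: algebra_simps power2_eq_square)
    ultimately have "(?y - 1)\<^sup>2 * poly q ?y = (-1) ^ k * extremal_value n - (1 - ?y) * poly p ?y"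
      by (metis minus_diff_eq minus_mult_left diff_minus_eq_add add.commute uminus_add_conv_diff)
    moreover have "\<bar>(1 - ?y) * poly p ?y\<bar> \<le> extremal_value n"
      using bd x[OF k] by simp
    \<comment> \<open>After multiplication by the sign, the right side is
      \<open>extremal_value n\<close> minus a number of modulus at most
      \<open>extremal_value n\<close>.\<close>
    ultimately have "(-1) ^ k * ((?y - 1)\<^sup>2 * poly q ?y) \<ge> 0"
      by (cases "even k") auto
    then have "(?y - 1)\<^sup>2 * ((-1) ^ k * poly q ?y) \<ge> 0"
      by (simp only: mult.left_commute)
    moreover have "(?y - 1)\<^sup>2 > 0"
      using x[OF k] by simp
    ultimately show "(-1) ^ k * poly q ?y \<ge> 0"
      by (metis mult_pos_neg not_le)
  qed
  with q0 show False by contradiction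
qed

lemma abs_extremal_poly_le:
  assumes "n > 0" "x \<in> {-1..1}"
  shows "\<bar>(1 - x) * poly (extremal_poly n) x\<bar> \<le> extremal_value n"
proof -
  have "poly (scaled_T n) x = poly ([:-1, 1:] * extremal_poly n) x"
    by (simp only: extremal_poly_exact[OF assms(1)])
  also have "\<dots> = - ((1 - x) * poly (extremal_poly n) x)"
    by (simp add: algebra_simps)
  finally show ?thesis
    using abs_scaled_T_le[OF assms] by simp
qed

text \<open>The witness is -1: the affine change of variable fixes it, and
  \<open>chebyshev_T n\<close> has modulus 1 at \<open>cos pi\<close>.\<close>

lemma extremal_poly_attains:
  assumes "n > 0"
  obtains x where "x \<in> {-1..1}" "\<bar>(1 - x) * poly (extremal_poly n) x\<bar> = extremal_value n"
proof
  have "poly ([:-1, 1:] * extremal_poly n) (-1) = extremal_value n * poly (chebyshev_T n) (cos pi)"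
    by (simp only: extremal_poly_exact[OF assms] poly_scaled_T) simp
  also have "\<dots> = extremal_value n * (-1) ^ n"
    by (simp only: chebyshev_T_cos cos_npi)
  finally have "\<bar>- 2 * poly (extremal_poly n) (-1)\<bar> = \<bar>extremal_value n * (-1) ^ n\<bar>"
    by simp
  then show "\<bar>(1 - (-1)) * poly (extremal_poly n) (-1)\<bar> = extremal_value n"
    using extremal_value_pos[OF assms] by (simp add: abs_mult power_abs)
qed simp

theorem theorem3:
  fixes n :: nat and p :: "real poly"
  assumes "n > 0"
    and "degree p \<le> n - 1"
    and "poly p 1 = 1"
  shows "(SUP x\<in>{-1..1::real}. \<bar>(1 - x) * poly p x\<bar>) \<ge> extremal_value n \<and>
    ((SUP x\<in>{-1..1::real}. \<bar>(1 - x) * poly p x\<bar>) = extremal_value n \<longleftrightarrow> p = extremal_poly n)"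
proof -
  let ?M = "\<lambda>q. SUP x\<in>{-1..1::real}. \<bar>(1 - x) * poly q x\<bar>"
  have extremal: "p = extremal_poly n" if "?M p \<le> extremal_value n"
  proof (rule eq_extremal_poly_if_bounded[OF assms])
    show "\<bar>(1 - x) * poly p x\<bar> \<le> extremal_value n" if "x \<in> {-1..1}" for x
      using SUP_attained[of p] that \<open>?M p \<le> _\<close> by (metis order.trans)
  qed
  moreover have "?M (extremal_poly n) = extremal_value n"
  proof -
    obtain x where "x \<in> {-1..1}" "\<bar>(1 - x) * poly (extremal_poly n) x\<bar> = extremal_value n"
      using extremal_poly_attains[OF assms(1)] .
    then show ?thesis
      by (intro cSup_eq_maximum) (auto simp: abs_extremal_poly_le[OF assms(1)] intro!: rev_image_eqI)
  qed
  \<comment> \<open>By linearity of the order, a maximum not above \<open>extremal_value n\<close>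
    forces \<open>p = extremal_poly n\<close>, and then equality holds.\<close>
  ultimately show ?thesis
    by (metis linear order.refl)
qed

end
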